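(* Let $\mathcal{K}$ be the set of $n$-variable bent functions arising from the Kerdock code. Given two $n$-variable bent functions $f,g$ (accessed through oracles) such that $f,g,\hat f\in\mathcal{K}$, where $\hat f$ is the dual of $f$, the problem of determining whether $g=\hat f$ or not can be efficiently solved by making one query each to $f$ and $g$, using the $2$-query $2$-fold Forrelation algorithm.
   Context: The Walsh transform of $f:\{0,1\}^n\to\{1,-1\}$ is $W_f(\boldsymbol{\omega})=\sum_{\mathbf{x}\in\{0,1\}^n}f(\mathbf{x})(-1)^{\mathbf{x}\cdot\boldsymbol{\omega}}$, where $\mathbf{x}\cdot\boldsymbol{\omega}=x_1\omega_1\oplus\cdots\oplus x_n\omega_n$. For $n$ even, $f$ is bent if $W_f(\boldsymbol{\omega})=\pm2^{n/2}$ for all $\boldsymbol{\omega}\in\{0,1\}^n$. The dual of a bent function $f$ is the bent function $\hat f:\{0,1\}^n\to\{1,-1\}$ with $W_f(\boldsymbol{\omega})=2^{n/2}\hat f(\boldsymbol{\omega})$ and $W_{\hat f}(\boldsymbol{\omega})=2^{n/2}f(\boldsymbol{\omega})$ for all $\boldsymbol{\omega}$. For $\pm1$-valued functions, $f\oplus g$ denotes the function with value $f(\mathbf{x})g(\mathbf{x})$ at $\mathbf{x}$. The property of $\mathcal{K}$ that is used: for any two distinct $f_1,f_2\in\mathcal{K}$, $f_1\oplus f_2$ is also bent. A query to $h:\{0,1\}^n\to\{1,-1\}$ is one application of $U_h|\mathbf{x}\rangle|a\rangle=|\mathbf{x}\rangle\left|a\oplus\frac{1-h(\mathbf{x})}{2}\right\rangle$.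 The $2$-query $2$-fold Forrelation algorithm (of Aaronson et al.) on $(f_1,f_2)$: start from $|0\rangle^{\otimes n}|-\rangle$, with $|-\rangle=\frac1{\sqrt2}(|0\rangle-|1\rangle)$; apply in order $H^{\otimes n}$, $U_{f_1}$, $H^{\otimes n}$, $U_{f_2}$, $H^{\otimes n}$ (with $H$ the Hadamard gate and $H^{\otimes n}$ acting on the first $n$ qubits); measure the first $n$ qubits in the computational basis. The all-zero string is obtained with probability $(\Phi_{f_1,f_2})^2$, where $\Phi_{f_1,f_2}=\frac{1}{2^{3n/2}}\sum_{\mathbf{x}\in\{0,1\}^n}f_1(\mathbf{x})W_{f_2}(\mathbf{x})$ is the $2$-fold Forrelation. "Efficiently" is used informally, without a stated error bound: the problem is not claimed to be solved deterministically, but with good probability using a constant number of queries. *)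

theory Defs
  imports "HOL-Analysis.Analysis"
begin

section \<open>Boolean functions, Walsh transform, bent functions\<close>

text \<open>
  A point of \<open>{0,1}\<^sup>n\<close> is a vector of type \<open>bool^'n\<close> with \<open>n = CARD('n)\<close>, and \<open>True\<close> is
  the bit \<open>1\<close>. A function into \<open>{1,-1}\<close> is an integer-valued function satisfying
  \<open>pm_one\<close>; the exclusive or of two such functions is their pointwise product.
\<close>

type_synonym 'n bfun = "bool^'n \<Rightarrow> int"

definition pm_one :: "'n::finite bfun \<Rightarrow> bool" where
  "pm_one f \<longleftrightarrow> (\<forall>x. f x = 1 \<or> f x = -1)"

definition zero_string :: "bool^'n::finite" where
  "zero_string = (\<chi> i. False)"

definition dot :: "bool^'n::finite \<Rightarrow> bool^'n \<Rightarrow> nat" where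
  "dot x w = (\<Sum>i\<in>UNIV. of_bool (x $ i \<and> w $ i)) mod 2"

definition walsh :: "'n::finite bfun \<Rightarrow> bool^'n \<Rightarrow> int" where
  "walsh f w = (\<Sum>x\<in>UNIV. f x * (-1) ^ dot x w)"

definition xor_fun :: "'n::finite bfun \<Rightarrow> 'n bfun \<Rightarrow> 'n bfun" where
  "xor_fun f g = (\<lambda>x. f x * g x)"

definition bent :: "'n::finite bfun \<Rightarrow> bool" where
  "bent f \<longleftrightarrow> even CARD('n) \<and> pm_one f \<and>
     (\<forall>w. walsh f w = 2 ^ (CARD('n) div 2) \<or> walsh f w = - (2 ^ (CARD('n) div 2)))"

text \<open>Meaningful for bent \<open>f\<close> only; there it is well defined by \<open>ex1_dual\<close> below.\<close>

definition dual :: "'n::finite bfun \<Rightarrow> 'n bfun" where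
  "dual f = (THE h. bent h \<and>
     (\<forall>w. walsh f w = 2 ^ (CARD('n) div 2) * h w) \<and>
     (\<forall>w. walsh h w = 2 ^ (CARD('n) div 2) * f w))"

lemma dot_commute: "dot x w = dot w x"
  by (simp add: dot_def conj_commute)

lemma minus_one_power_dot:
  "(-1::int) ^ dot x w = (\<Prod>i\<in>UNIV. if x $ i \<and> w $ i then -1 else 1)"
proof -
  have "(-1::int) ^ dot x w = (-1) ^ (\<Sum>i\<in>UNIV. of_bool (x $ i \<and> w $ i))"
    by (simp add: dot_def minus_one_power_iff even_iff_mod_2_eq_zero)
  also have "\<dots> = (\<Prod>i\<in>UNIV. (-1) ^ of_bool (x $ i \<and> w $ i))"
    by (rule power_sum)
  also have "\<dots> = (\<Prod>i\<in>UNIV. if x $ i \<and> w $ i then -1 else 1)"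
    by (intro prod.cong) auto
  finally show ?thesis .
qed

lemma sum_characters:
  fixes x y :: "bool^'n::finite"
  shows "(\<Sum>w\<in>UNIV. (-1::int) ^ dot x w * (-1) ^ dot w y) = (if x = y then 2 ^ CARD('n) else 0)"
proof (cases "x = y")
  case True
  have "(-1::int) ^ dot x w * (-1) ^ dot w y = 1" for w
    using True by (simp add: dot_commute[of w] flip: power_add mult_2)
  moreover have "CARD(bool^'n) = 2 ^ CARD('n)"
    by simp
  ultimately show ?thesis
    using True by simp
next
  case False
  then obtain i where i: "x $ i \<noteq> y $ i"
    by (auto simp: vec_eq_iff)
  define flip where "flip w = (\<chi> j. if j = i then \<not> w $ j else w $ j)" for w :: "bool^'n"
  define s where "s w = (-1::int) ^ dot x w * (-1) ^ dot w y" for w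
  have flip: "flip (flip w) = w" for w
    by (auto simp: flip_def vec_eq_iff)
  have prod: "s w = (\<Prod>j\<in>UNIV. if x $ j \<noteq> y $ j \<and> w $ j then -1 else 1)" for w
    unfolding s_def minus_one_power_dot prod.distrib[symmetric] by (intro prod.cong) auto
  have "s (flip w) = - s w" for w
  proof -
    have "s v = (if v $ i then -1 else 1) *
        (\<Prod>j\<in>UNIV-{i}. if x $ j \<noteq> y $ j \<and> v $ j then -1 else 1)" for v
      unfolding prod using i by (subst prod.remove[of _ i]) auto
    moreover have "(\<Prod>j\<in>UNIV-{i}. if x $ j \<noteq> y $ j \<and> flip w $ j then -1 else (1::int)) =
        (\<Prod>j\<in>UNIV-{i}. if x $ j \<noteq> y $ j \<and> w $ j then -1 else 1)"
      by (intro prod.cong) (auto simp: flip_def)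
    ultimately show ?thesis
      by (simp add: flip_def)
  qed
  moreover have "(\<Sum>w\<in>UNIV. s w) = (\<Sum>w\<in>UNIV. s (flip w))"
    by (rule sum.reindex_bij_witness[where i = flip and j = flip]) (auto simp: flip)
  ultimately have "(\<Sum>w\<in>UNIV. s w) = - (\<Sum>w\<in>UNIV. s w)"
    by (simp add: sum_negf)
  then show ?thesis
    using False by (simp add: s_def)
qed

lemma walsh_walsh: "walsh (walsh f) y = 2 ^ CARD('n) * f (y :: bool^'n::finite)"
proof -
  have "walsh (walsh f) y = (\<Sum>w\<in>UNIV. \<Sum>x\<in>UNIV. f x * ((-1) ^ dot x w * (-1) ^ dot w y))"
    unfolding walsh_def by (simp add: sum_distrib_right mult.assoc)
  also have "\<dots> = (\<Sum>x\<in>UNIV. f x * (\<Sum>w\<in>UNIV. (-1) ^ dot x w * (-1) ^ dot w y))"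
    by (subst sum.swap) (simp add: sum_distrib_left)
  also have "\<dots> = (\<Sum>x\<in>UNIV. if x = y then f x * 2 ^ CARD('n) else 0)"
    unfolding sum_characters by (intro sum.cong) auto
  finally show ?thesis by simp
qed

lemma ex1_dual:
  fixes f :: "'n::finite bfun"
  assumes "bent f"
  shows "\<exists>!h. bent h \<and>
     (\<forall>w. walsh f w = 2 ^ (CARD('n) div 2) * h w) \<and>
     (\<forall>w. walsh h w = 2 ^ (CARD('n) div 2) * f w)"
proof -
  define c :: int where "c = 2 ^ (CARD('n) div 2)"
  have c: "c \<noteq> 0" "2 ^ CARD('n) = c * c"
    using assms by (auto simp: c_def bent_def simp flip: power_add mult_2)
  define h where "h w = walsh f w div c" for w
  have pm: "f w = 1 \<or> f w = -1" for w
    using assms by (simp add: bent_def pm_one_def)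
  have h: "walsh f w = c * h w \<and> (h w = 1 \<or> h w = -1)" for w
  proof -
    have "walsh f w = c * 1 \<or> walsh f w = c * (-1)"
      using assms by (simp add: bent_def c_def)
    then show ?thesis
      using c(1) unfolding h_def by (elim disjE) (simp_all del: mult_minus_right mult_minus1_right)
  qed
  have wh: "walsh h w = c * f w" for w
  proof -
    have "c * walsh h w = walsh (walsh f) w"
      using h by (simp add: walsh_def[of h] walsh_def[of "walsh f"] sum_distrib_left mult.assoc)
    then show ?thesis
      using c walsh_walsh[of f w] by simp
  qed
  have hb: "bent h"
    unfolding bent_def pm_one_def c_def[symmetric]
  proof (intro conjI allI)
    show "even CARD('n)" using assms by (simp add: bent_def)
    show "h w = 1 \<or> h w = -1" for w using h by blast
    show "walsh h w = c \<or> walsh h w = - c" for w using pm[of w] wh[of w] by auto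
  qed
  show ?thesis
    unfolding c_def[symmetric]
  proof (rule ex1I[of _ h])
    show "bent h \<and> (\<forall>w. walsh f w = c * h w) \<and> (\<forall>w. walsh h w = c * f w)"
      using hb h wh by blast
    show "k = h"
      if "bent k \<and> (\<forall>w. walsh f w = c * k w) \<and> (\<forall>w. walsh k w = c * f w)" for k
      using that h c(1) by (metis ext mult_cancel_left)
  qed
qed

lemma dual_props:
  fixes f :: "'n::finite bfun"
  assumes "bent f"
  shows "bent (dual f)"
    and "walsh f w = 2 ^ (CARD('n) div 2) * dual f w"
    and "walsh (dual f) w = 2 ^ (CARD('n) div 2) * f w"
  using theI'[OF ex1_dual[OF assms], folded dual_def] by blast+


section \<open>Kerdock codes\<close>

text \<open>
  Codewords of length \<open>2\<^sup>n\<close> are identified with functions into \<open>{1,-1}\<close>, so that codeword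
  addition is \<open>xor_fun\<close>. In the Reed--Muller code of order \<open>r\<close>, the set \<open>A\<close> consists of
  the monomials (given by their sets of variables) in the algebraic normal form.
\<close>

definition reed_muller :: "nat \<Rightarrow> 'n::finite bfun set" where
  "reed_muller r = {f. \<exists>A. (\<forall>S\<in>A. card S \<le> r) \<and>
     f = (\<lambda>x. (-1) ^ card {S\<in>A. \<forall>i\<in>S. x $ i})}"

text \<open>
  A Kerdock code of length \<open>2\<^sup>n\<close>, \<open>n\<close> even, is the union of the first-order Reed--Muller
  code, of size \<open>2\<^sup>n\<^sup>+\<^sup>1\<close>, and \<open>2\<^sup>n\<^sup>-\<^sup>1 - 1\<close> further cosets of it in the second-order one,
  such that the sum of words from different cosets is bent.
\<close>

definition kerdock_code :: "'n::finite bfun set \<Rightarrow> bool" where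
  "kerdock_code C \<longleftrightarrow>
     even CARD('n) \<and>
     reed_muller 1 \<subseteq> C \<and> C \<subseteq> reed_muller 2 \<and>
     (\<forall>f\<in>C. \<forall>l\<in>reed_muller 1. xor_fun f l \<in> C) \<and>
     card C = 2 ^ (2 * CARD('n)) \<and>
     (\<forall>f\<in>C. \<forall>g\<in>C. xor_fun f g \<notin> reed_muller 1 \<longrightarrow> bent (xor_fun f g))"

text \<open>
  Two bent functions of the same coset differ by an affine function, so their sum is not
  bent; hence one function is taken from each nontrivial coset.
\<close>

definition kerdock_bent_set :: "'n::finite bfun set \<Rightarrow> bool" where
  "kerdock_bent_set K \<longleftrightarrow> (\<exists>C. kerdock_code C \<and>
     K \<subseteq> C - reed_muller 1 \<and> (\<forall>f\<in>K. bent f) \<and>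
     (\<forall>h\<in>C - reed_muller 1. \<exists>!f. f \<in> K \<and> xor_fun h f \<in> reed_muller 1))"

lemma kerdock_bent_set_pairwise_bent:
  assumes "kerdock_bent_set K" "f1 \<in> K" "f2 \<in> K" "f1 \<noteq> f2"
  shows "bent (xor_fun f1 f2)"
proof (rule ccontr)
  assume nb: "\<not> bent (xor_fun f1 f2)"
  obtain C where C: "kerdock_code C" "K \<subseteq> C - reed_muller 1" "\<And>f. f \<in> K \<Longrightarrow> bent f"
    and ex1: "\<And>h. h \<in> C - reed_muller 1 \<Longrightarrow> \<exists>!f. f \<in> K \<and> xor_fun h f \<in> reed_muller 1"
    using assms(1) unfolding kerdock_bent_set_def by blast
  have one: "(\<lambda>_. 1) \<in> reed_muller 1"
    unfolding reed_muller_def by (intro CollectI exI[of _ "{}"]) simp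
  have "f1 x * f1 x = 1" for x
  proof -
    have "f1 x = 1 \<or> f1 x = -1"
      using C(3)[OF assms(2)] by (simp add: bent_def pm_one_def)
    then show ?thesis by auto
  qed
  then have "xor_fun f1 f1 = (\<lambda>_. 1)"
    by (simp add: xor_fun_def)
  moreover have "xor_fun f1 f2 \<in> reed_muller 1"
    using nb C assms unfolding kerdock_code_def by blast
  moreover have "f1 \<in> C - reed_muller 1"
    using C assms by blast
  ultimately show False
    using ex1[of f1] one assms by metis
qed


section \<open>Quantum query algorithms with two oracles\<close>

text \<open>
  The register consists of the \<open>n\<close> qubits of the input followed by one target qubit; a state
  is its vector of amplitudes in the computational basis.
\<close>

type_synonym 'n basis = "(bool^'n) \<times> bool"
type_synonym 'n state = "complex ^ 'n basis"
type_synonym 'n operator = "complex ^ 'n basis ^ 'n basis"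

definition hadamard :: "bool \<Rightarrow> bool \<Rightarrow> complex" where
  "hadamard a b = (if a \<and> b then -1 else 1) / complex_of_real (sqrt 2)"

text \<open>Tensor power of the Hadamard gate on the input qubits, identity on the target qubit.\<close>

definition hadamard_op :: "'n::finite operator" where
  "hadamard_op = (\<chi> p q. (\<Prod>i\<in>UNIV. hadamard (fst p $ i) (fst q $ i)) * of_bool (snd p = snd q))"

text \<open>
  The column of the basis state \<open>(x, a)\<close> is the basis state \<open>(x, a \<oplus> (1 - h x) / 2)\<close>;
  exclusive or on \<open>bool\<close> is \<open>\<noteq>\<close>.
\<close>

definition query_op :: "'n::finite bfun \<Rightarrow> 'n operator" where
  "query_op h = (\<chi> p q. of_bool (p = (fst q, snd q \<noteq> ((1 - h (fst q)) div 2 = 1))))"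

datatype oracle_label = Oracle1 | Oracle2

datatype gate = Hadamards | Query oracle_label

primrec gate_op :: "(oracle_label \<Rightarrow> 'n::finite bfun) \<Rightarrow> gate \<Rightarrow> 'n operator" where
  "gate_op orc Hadamards = hadamard_op"
| "gate_op orc (Query j) = query_op (orc j)"

text \<open>The gates are applied in list order, the head of the list first.\<close>

definition run_circuit :: "(oracle_label \<Rightarrow> 'n::finite bfun) \<Rightarrow> gate list \<Rightarrow> 'n state \<Rightarrow> 'n state" where
  "run_circuit orc gs v = fold (\<lambda>g u. gate_op orc g *v u) gs v"

definition query_count :: "oracle_label \<Rightarrow> gate list \<Rightarrow> nat" where
  "query_count j gs = count_list gs (Query j)"

definition initial_state :: "'n::finite state" where
  "initial_state = (\<chi> p. of_bool (fst p = zero_string) *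
     ((if snd p then -1 else 1) / complex_of_real (sqrt 2)))"

text \<open>Measurement of the input qubits only, so the target qubit is summed out.\<close>

definition outcome_prob :: "'n::finite state \<Rightarrow> bool^'n \<Rightarrow> real" where
  "outcome_prob v y = (\<Sum>a\<in>UNIV. (cmod (v $ (y, a)))\<^sup>2)"

definition forrelation_circuit :: "gate list" where
  "forrelation_circuit = [Hadamards, Query Oracle1, Hadamards, Query Oracle2, Hadamards]"

definition forrelation_prob :: "'n::finite bfun \<Rightarrow> 'n bfun \<Rightarrow> bool^'n \<Rightarrow> real" where
  "forrelation_prob f1 f2 y = outcome_prob
     (run_circuit (case_oracle_label f1 f2) forrelation_circuit initial_state) y"

text \<open>Probability of the answer \<open>ans\<close> when the answer is ``yes'' iff the all-zero string is measured.\<close>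

definition answer_prob :: "'n::finite bfun \<Rightarrow> 'n bfun \<Rightarrow> bool \<Rightarrow> real" where
  "answer_prob f1 f2 ans = (\<Sum>y | (y = zero_string) = ans. forrelation_prob f1 f2 y)"

end

theory Submission
  imports Defs
begin

text \<open>
  With the target qubit in \<open>|-\<rangle>\<close> a query multiplies the amplitudes by the signs of the queried
  function, so the circuit only acts on a real amplitude function on \<open>{0,1}\<^sup>n\<close>. The final
  amplitude of the all-zero string is the normalised correlation of \<open>g\<close> with the Walsh
  transform of \<open>f\<close>, that is, with \<open>dual f\<close>; it is the value at zero of the Walsh transform of
  \<open>xor_fun (dual f) g\<close>, divided by \<open>2\<^sup>n\<close>. This is \<open>1\<close> if \<open>g = dual f\<close>, and otherwise
  \<open>\<plusminus> 2\<^bsup>-n/2\<^esup>\<close>, as the product of distinct members of a Kerdock set is bent. The probabilities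
  of all outcomes add up to \<open>1\<close> by Parseval's identity.
\<close>

text \<open>The product state of \<open>u\<close> with the target qubit in |->. Real amplitudes
  suffice because the Hadamard gates and the query signs are real.\<close>

definition ket_minus :: "(bool^'n::finite \<Rightarrow> real) \<Rightarrow> 'n state" where
  "ket_minus u = (\<chi> p. complex_of_real (u (fst p) * (if snd p then -1 else 1) / sqrt 2))"

text \<open>The Walsh transform in its unitary normalisation; \<open>sqrt 2 ^ CARD('n)\<close>
  avoids halving the dimension, so no parity assumption is needed here.\<close>

definition hadamard_transform :: "(bool^'n::finite \<Rightarrow> real) \<Rightarrow> bool^'n \<Rightarrow> real" where
  "hadamard_transform u x = (\<Sum>y\<in>UNIV. (-1) ^ dot x y * u y) / sqrt 2 ^ CARD('n)"

lemma dot_zero_left: "dot zero_string x = 0"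
  by (simp add: dot_def zero_string_def)

lemma dot_zero_right: "dot x zero_string = 0"
  by (simp add: dot_def zero_string_def)

lemma sum_UNIV_prod_bool:
  fixes F :: "'a::finite \<times> bool \<Rightarrow> 'b::comm_monoid_add"
  shows "(\<Sum>q\<in>UNIV. F q) = (\<Sum>y\<in>UNIV. F (y, False) + F (y, True))"
proof -
  have "(\<Sum>q\<in>UNIV. F q) = (\<Sum>y\<in>UNIV. \<Sum>a\<in>UNIV. F (y, a))"
    by (simp add: sum.cartesian_product)
  then show ?thesis
    by (simp add: UNIV_bool)
qed

lemma prod_hadamard:
  "(\<Prod>i\<in>UNIV. hadamard (x $ i) (y $ i)) =
     complex_of_real ((-1) ^ dot x y / sqrt 2 ^ CARD('n))"
  for x y :: "bool^'n::finite"
proof -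
  have "complex_of_real ((-1) ^ dot x y) = of_int ((-1) ^ dot x y)"
    by simp
  also have "\<dots> = (\<Prod>i\<in>UNIV. if x $ i \<and> y $ i then -1 else 1)"
    unfolding minus_one_power_dot of_int_prod by (intro prod.cong) auto
  finally show ?thesis
    by (simp add: hadamard_def prod_dividef)
qed

lemma outcome_prob_ket_minus: "outcome_prob (ket_minus u) y = (u y)\<^sup>2"
  by (simp add: outcome_prob_def ket_minus_def UNIV_bool norm_divide norm_mult power_divide)

lemma initial_state_eq_ket_minus: "initial_state = ket_minus (\<lambda>x. of_bool (x = zero_string))"
  by (simp add: initial_state_def ket_minus_def vec_eq_iff)

lemma hadamard_op_ket_minus:
  "hadamard_op *v ket_minus u = ket_minus (hadamard_transform u)"
  for u :: "bool^'n::finite \<Rightarrow> real"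
proof -
  have "(hadamard_op *v ket_minus u) $ (x, a) = ket_minus (hadamard_transform u) $ (x, a)" for x a
  proof -
    have "(hadamard_op *v ket_minus u) $ (x, a) = (\<Sum>y\<in>UNIV.
        complex_of_real ((-1) ^ dot x y / sqrt 2 ^ CARD('n)) *
        complex_of_real (u y * (if a then -1 else 1) / sqrt 2))"
      unfolding matrix_vector_mult_def hadamard_op_def vec_lambda_beta sum_UNIV_prod_bool
        prod_hadamard
      by (intro sum.cong) (auto simp: ket_minus_def)
    also have "\<dots> = ket_minus (hadamard_transform u) $ (x, a)"
      by (simp add: ket_minus_def hadamard_transform_def sum_distrib_right sum_divide_distrib
          sum_negf mult.assoc)
    finally show ?thesis .
  qed
  then show ?thesis
    by (simp add: vec_eq_iff)
qed

text \<open>Phase kickback: where \<open>h x = -1\<close> the query exchanges the two target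
  amplitudes, which are opposite in |->, so the sign moves to the input register.\<close>

lemma query_op_ket_minus:
  assumes "pm_one h"
  shows "query_op h *v ket_minus u = ket_minus (\<lambda>x. of_int (h x) * u x)"
proof -
  have "(query_op h *v ket_minus u) $ (x, a) = ket_minus (\<lambda>x. of_int (h x) * u x) $ (x, a)" for x a
  proof -
    have pm: "h x = 1 \<or> h x = -1"
      using assms by (simp add: pm_one_def)
    have "(query_op h *v ket_minus u) $ (x, a) = (\<Sum>y\<in>UNIV. if x = y then
        of_bool (a = ((1 - h y) div 2 = 1)) * ket_minus u $ (y, False) +
        of_bool (a = (True \<noteq> ((1 - h y) div 2 = 1))) * ket_minus u $ (y, True) else 0)"
      unfolding matrix_vector_mult_def query_op_def vec_lambda_beta sum_UNIV_prod_bool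
      by (intro sum.cong) auto
    also have "\<dots> = ket_minus (\<lambda>x. of_int (h x) * u x) $ (x, a)"
      using pm by (auto simp: ket_minus_def)
    finally show ?thesis .
  qed
  then show ?thesis
    by (simp add: vec_eq_iff)
qed

text \<open>After expanding the square and summing over \<open>x\<close> first, orthogonality of the
  characters leaves only the diagonal terms \<open>y = z\<close>.\<close>

lemma parseval:
  fixes u :: "bool^'n::finite \<Rightarrow> real"
  shows "(\<Sum>x\<in>UNIV. (hadamard_transform u x)\<^sup>2) = (\<Sum>x\<in>UNIV. (u x)\<^sup>2)"
proof -
  have char: "(\<Sum>x\<in>UNIV. (-1::real) ^ dot y x * (-1) ^ dot x z) =
      (if y = z then 2 ^ CARD('n) else 0)" for y z :: "bool^'n"
    using arg_cong[OF sum_characters[of y z], of real_of_int] by (simp split: if_splits)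
  have "(\<Sum>x\<in>UNIV. (\<Sum>y\<in>UNIV. (-1) ^ dot x y * u y)\<^sup>2) =
      (\<Sum>x\<in>UNIV. \<Sum>y\<in>UNIV. \<Sum>z\<in>UNIV. u y * u z * ((-1) ^ dot y x * (-1) ^ dot x z))"
    unfolding power2_eq_square sum_product
    by (intro sum.cong refl) (simp add: dot_commute mult_ac)
  also have "\<dots> = (\<Sum>y\<in>UNIV. \<Sum>z\<in>UNIV. \<Sum>x\<in>UNIV. u y * u z * ((-1) ^ dot y x * (-1) ^ dot x z))"
    by (subst sum.swap, rule sum.cong[OF refl], rule sum.swap)
  also have "\<dots> = (\<Sum>y\<in>UNIV. \<Sum>z\<in>UNIV. if y = z then u y * u z * 2 ^ CARD('n) else 0)"
    unfolding sum_distrib_left[symmetric] char by (intro sum.cong) auto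
  also have "\<dots> = 2 ^ CARD('n) * (\<Sum>x\<in>UNIV. (u x)\<^sup>2)"
    by (simp add: power2_eq_square sum_distrib_left mult_ac)
  \<comment> \<open>The squared normaliser is first merged into the exponent
    \<open>2 * CARD('n)\<close>, then split again as a power of
    \<open>(sqrt 2)\<^sup>2\<close>.\<close>
  finally show ?thesis
    by (simp add: hadamard_transform_def power_divide power_mult[symmetric] mult.commute[of _ 2]
        flip: sum_divide_distrib) (simp add: power_mult)
qed

lemma hadamard_transform_zero_string:
  "hadamard_transform (\<lambda>x :: bool^'n::finite. of_bool (x = zero_string)) =
     (\<lambda>x. 1 / sqrt 2 ^ CARD('n))"
proof -
  have "(\<Sum>y\<in>UNIV. (-1) ^ dot x y * of_bool (y = zero_string)) =
      (\<Sum>y\<in>UNIV. if y = (zero_string :: bool^'n) then 1 else (0::real))" for x :: "bool^'n"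
    by (intro sum.cong) (auto simp: dot_zero_right)
  then show ?thesis
    by (simp add: hadamard_transform_def fun_eq_iff)
qed

text \<open>The final amplitudes of the circuit, with the first Hadamard layer already evaluated to
  the uniform superposition.\<close>

definition forrelation_amplitude :: "'n::finite bfun \<Rightarrow> 'n bfun \<Rightarrow> bool^'n \<Rightarrow> real" where
  "forrelation_amplitude f g = hadamard_transform (\<lambda>y. of_int (g y) *
     hadamard_transform (\<lambda>x. of_int (f x) / sqrt 2 ^ CARD('n)) y)"

lemma forrelation_prob_eq_amplitude:
  fixes f g :: "'n::finite bfun"
  assumes "pm_one f" "pm_one g"
  shows "forrelation_prob f g y = (forrelation_amplitude f g y)\<^sup>2"
  using assms
  by (simp add: forrelation_prob_def run_circuit_def forrelation_circuit_def
      initial_state_eq_ket_minus hadamard_op_ket_minus query_op_ket_minus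
      hadamard_transform_zero_string outcome_prob_ket_minus forrelation_amplitude_def)

lemma sum_forrelation_prob:
  fixes f g :: "'n::finite bfun"
  assumes "pm_one f" "pm_one g"
  shows "(\<Sum>y\<in>UNIV. forrelation_prob f g y) = 1"
proof -
  have sq: "(real_of_int (h x))\<^sup>2 = 1" if "pm_one h" for h :: "'n bfun" and x
    using that unfolding pm_one_def by (metis of_int_1 of_int_minus power2_minus one_power2)
  have "(\<Sum>y\<in>UNIV. forrelation_prob f g y) =
      (\<Sum>x\<in>UNIV. (real_of_int (f x) / sqrt 2 ^ CARD('n))\<^sup>2)"
    by (simp add: forrelation_prob_eq_amplitude[OF assms] forrelation_amplitude_def parseval
        power_mult_distrib sq[OF assms(2)])
  also have "\<dots> = (\<Sum>x\<in>(UNIV :: (bool^'n) set). 1 / 2 ^ CARD('n))"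
    by (simp add: power_divide sq[OF assms(1)] power_mult[symmetric] mult.commute[of _ 2])
      (simp add: power_mult)
  finally show ?thesis
    by simp
qed

lemma answer_prob_True: "answer_prob f g True = forrelation_prob f g zero_string"
  by (simp add: answer_prob_def)

lemma answer_prob_False:
  assumes "pm_one f" "pm_one g"
  shows "answer_prob f g False = 1 - forrelation_prob f g zero_string"
proof -
  have "answer_prob f g False = (\<Sum>y\<in>UNIV - {zero_string}. forrelation_prob f g y)"
    unfolding answer_prob_def by (intro sum.cong) auto
  then show ?thesis
    using sum_forrelation_prob[OF assms] by (simp add: sum_diff1)
qed

text \<open>At the all-zero string all signs of the outer transform are 1, leaving a plain sum;
  bentness turns the inner transform into \<open>dual f\<close> up to scaling.\<close>

lemma forrelation_amplitude_zero_string: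
  fixes f g :: "'n::finite bfun"
  assumes "bent f"
  shows "forrelation_amplitude f g zero_string =
    of_int (walsh (xor_fun (dual f) g) zero_string) / 2 ^ CARD('n)"
proof -
  let ?s = "sqrt 2 ^ CARD('n)"
  have "even CARD('n)"
    using assms by (simp add: bent_def)
  \<comment> \<open>For even dimension the bent normalisation agrees with that of the gates.\<close>
  then have s: "2 ^ (CARD('n) div 2) = ?s"
    by (metis even_two_times_div_two power_mult real_sqrt_pow2 zero_le_numeral)
  have s2: "?s * ?s = 2 ^ CARD('n)"
    by (simp flip: power_mult_distrib)
  have "hadamard_transform (\<lambda>x. of_int (f x) / ?s) y = of_int (walsh f y) / (?s * ?s)" for y
    by (simp add: hadamard_transform_def walsh_def dot_commute[of y] mult.commute
        flip: sum_divide_distrib)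
  also have "of_int (walsh f y) / (?s * ?s) = of_int (dual f y) / ?s" for y
    by (simp add: dual_props(2)[OF assms] s)
  finally show ?thesis
    unfolding forrelation_amplitude_def
    by (simp add: hadamard_transform_def walsh_def dot_zero_left dot_zero_right xor_fun_def
        mult.commute flip: sum_divide_distrib s2)
qed

lemma forrelation_prob_dual:
  fixes f :: "'n::finite bfun"
  assumes "bent f"
  shows "forrelation_prob f (dual f) zero_string = 1"
proof -
  have pm: "pm_one f" "pm_one (dual f)"
    using assms dual_props(1)[OF assms] by (simp_all add: bent_def)
  have "dual f x * dual f x = 1" for x
    using pm(2) unfolding pm_one_def by (metis mult_1 mult_minus1 minus_minus)
  then have "walsh (xor_fun (dual f) (dual f)) zero_string = 2 ^ CARD('n)"
    by (simp add: walsh_def xor_fun_def dot_zero_right)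
  then show ?thesis
    by (simp add: forrelation_prob_eq_amplitude[OF pm] forrelation_amplitude_zero_string[OF assms])
qed

text \<open>Bentness fixes the Walsh value at zero up to sign, and squaring removes the
  sign.\<close>

lemma forrelation_prob_bent_xor_dual:
  fixes f g :: "'n::finite bfun"
  assumes "bent f" "pm_one g" "bent (xor_fun (dual f) g)"
  shows "forrelation_prob f g zero_string = 1 / 2 ^ CARD('n)"
proof -
  have pm: "pm_one f"
    using assms(1) by (simp add: bent_def)
  let ?w = "real_of_int (walsh (xor_fun (dual f) g) zero_string)"
  have "even CARD('n)"
    using assms(1) by (simp add: bent_def)
  then have "(2 ^ (CARD('n) div 2))\<^sup>2 = (2::real) ^ CARD('n)"
    by (simp flip: power_mult)
  moreover have "walsh (xor_fun (dual f) g) zero_string = 2 ^ (CARD('n) div 2) \<or>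
      walsh (xor_fun (dual f) g) zero_string = - (2 ^ (CARD('n) div 2))"
    using assms(3) unfolding bent_def by blast
  ultimately have "?w\<^sup>2 = 2 ^ CARD('n)"
    by auto
  then show ?thesis
    by (simp add: forrelation_prob_eq_amplitude[OF pm assms(2)]
        forrelation_amplitude_zero_string[OF assms(1)] power_divide power2_eq_square)
qed

theorem proposition4:
  fixes K :: "'n::finite bfun set" and f g :: "'n bfun"
  assumes "kerdock_bent_set K"
    and "bent f" and "bent g"
    and "f \<in> K" and "g \<in> K" and "dual f \<in> K"
  shows "query_count Oracle1 forrelation_circuit = 1 \<and>
         query_count Oracle2 forrelation_circuit = 1 \<and>
         (g = dual f \<longrightarrow> answer_prob f g True = 1) \<and>
         (g \<noteq> dual f \<longrightarrow> answer_prob f g False = 1 - 1 / 2 ^ CARD('n) \<and>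
                         answer_prob f g False \<ge> 2 / 3)"
proof -
  have pm: "pm_one f" "pm_one g"
    using assms by (simp_all add: bent_def)
  \<comment> \<open>Here \<open>dual f\<close> and \<open>g\<close> are distinct members of
    \<open>K\<close>, so their product is bent.\<close>
  have prob: "answer_prob f g False = 1 - 1 / 2 ^ CARD('n)" if "g \<noteq> dual f"
    using forrelation_prob_bent_xor_dual[OF assms(2) pm(2)]
      kerdock_bent_set_pairwise_bent[OF assms(1,6,5)] answer_prob_False[OF pm] that by simp
  \<comment> \<open>Evenness excludes dimension 1, so the error is at most 1/4, below the 1/3
    allowed.\<close>
  have "even CARD('n)" "CARD('n) \<noteq> 0"
    using assms(2) by (simp_all add: bent_def)
  then have "2 \<le> CARD('n)"
    by presburger
  then have "(2::real) ^ 2 \<le> 2 ^ CARD('n)"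
    by (intro power_increasing) simp_all
  then have "1 / 2 ^ CARD('n) \<le> (1 / 3 :: real)"
    by (simp add: field_simps)
  then show ?thesis
    using prob forrelation_prob_dual[OF assms(2)]
    by (auto simp: answer_prob_True query_count_def forrelation_circuit_def)
qed

end
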